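(* Let $m\ge4$ and let $W_m$ be the gradient field on $C_m$ constructed by the algorithm $\mathcal A$ with respect to the lexicographic order on the vertices $\begin{smallmatrix}a\\ b\end{smallmatrix}=(a,b)\in V_m\times V_m\setminus\Delta_{V_m}$ of $C_m$. The full list of $W_m$-pairings is: (a) $\left[\begin{smallmatrix}a&a\\ b&d\end{smallmatrix}\right]\nearrow\left[\begin{smallmatrix}a&a&m\\ b&d&d\end{smallmatrix}\right]$, for $a<m>d$. (b) $\left[\begin{smallmatrix}a&a\\ b&m\end{smallmatrix}\right]\nearrow\left[\begin{smallmatrix}a&a&m-1\\ b&m&m\end{smallmatrix}\right]$, for $a<m-1$. (c) $\left[\begin{smallmatrix}a&c\\ b&b\end{smallmatrix}\right]\nearrow\left[\begin{smallmatrix}a&c&c\\ b&b&m\end{smallmatrix}\right]$, for $b<m>c$. (d) $\left[\begin{smallmatrix}a&m\\ b&b\end{smallmatrix}\right]\nearrow\left[\begin{smallmatrix}a&m&m\\ b&b&m-1\end{smallmatrix}\right]$, for $b<m-1$. (e) $\left[\begin{smallmatrix}a&c\\ b&d\end{smallmatrix}\right]\nearrow\left[\begin{smallmatrix}a&c&c\\ b&b&d\end{smallmatrix}\right]$, for $a<c$, $b<d$, $b\ne c$ and either $c<m>d$ or $c=m>d+1$. (f) $\left[\begin{smallmatrix}a&c\\ b&d\end{smallmatrix}\right]\nearrow\left[\begin{smallmatrix}a&a&c\\ b&d&d\end{smallmatrix}\right]$, for $a<c$, $b<d$, $a\ne d$ and either $b=c<m>d$ or $c+1<m=d$. (g) $\left[\begin{smallmatrix}a\\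 b\end{smallmatrix}\right]\nearrow\left[\begin{smallmatrix}a&m\\ b&m-1\end{smallmatrix}\right]$, for either $b<m-1$ or $a<m-1=b$. (h) $\left[\begin{smallmatrix}a\\ m\end{smallmatrix}\right]\nearrow\left[\begin{smallmatrix}a&m-1\\ m&m\end{smallmatrix}\right]$, for $a<m-1$. (i) $\left[\begin{smallmatrix}m-1\\ m\end{smallmatrix}\right]\nearrow\left[\begin{smallmatrix}m-1&m-1\\ m-2&m\end{smallmatrix}\right]$. In particular, the critical faces (those in no pairing) are: (j) In dimension $0$, the vertex $\left[\begin{smallmatrix}m\\ m-1\end{smallmatrix}\right]$. (k) In dimension $1$, the simplices: (k.1) $\left[\begin{smallmatrix}a&m-1\\ b&m\end{smallmatrix}\right]$, with either $a=m-1>b+1$ or $a<m-1\ge b$; (k.2) $\left[\begin{smallmatrix}m&m\\ b&d\end{smallmatrix}\right]$, with $d<m-1$; (k.3) $\left[\begin{smallmatrix}a&c\\ m&m\end{smallmatrix}\right]$, with $c<m-1$. (l) In dimension $2$, the simplices $\left[\begin{smallmatrix}a&a&c\\ b&d&d\end{smallmatrix}\right]$ with $b\ne c<m>d$.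
   Context: $V_m=\{1,\ldots,m\}$ and $\Delta_{V_m}$ is its diagonal. $C_m$ is the following 2-dimensional simplicial complex (Munkres' model, with $|C_m|\simeq\mathrm{Conf}(|K_m|,2)$, the ordered configuration space of two points on the complete graph). Its vertices are the columns $\begin{smallmatrix}a\\ b\end{smallmatrix}$ with $a,b\in V_m$, $a\ne b$. Its $k$-faces are the arrays $\left[\begin{smallmatrix}a_0&\cdots&a_k\\ b_0&\cdots&b_k\end{smallmatrix}\right]$ with $a_0\le\cdots\le a_k$, $b_0\le\cdots\le b_k$, $a_j\ne b_j$ for all $j$, consecutive columns distinct, and with each of $\{a_0,\ldots,a_k\}$ and $\{b_0,\ldots,b_k\}$ having at most two elements (i.e. being a face of $K_m$). All conditions on $a,b,c,d\in V_m$ making a displayed array a face in this sense (with columns in the displayed order) are implicit and omitted; e.g. in (a) the conditions $a\ne b<d\ne a$ are implicit. Algorithm $\mathcal A$ on a finite simplicial complex $K$ of dimension $d$ with linearly ordered vertex set $(V,\preceq)$: let $\mathcal F^i$ be the set of $i$-faces (faces are nonempty), each written as the increasing tuple $[\alpha_0,\ldots,\alpha_i]$ of its vertices, $\alpha_r$ being in position $r$; faces are ordered lexicographically. Start with $W:=\varnothing$ and $F^i:=\mathcal F^i$ for all $i$. For $i=d-1,\ldots,0$ in this order (skipping $i$ if $F^i$ or $F^{i+1}$ is empty at that moment), for $r=i+1,i,\ldots,0$ in descending order, for $v\in V$ from the $\preceq$-largest to the smallest, and for $\alpha\in\mathcal F^i$ in increasing lexicographic order: if $v\notin\alpha$, $\alpha\cup\{v\}\in\mathcal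 F^{i+1}$ with $v$ in position $r$ of $\alpha\cup\{v\}$, and at that moment $\alpha\in F^i$ and $\alpha\cup\{v\}\in F^{i+1}$, then add the pairing $\alpha\nearrow\alpha\cup\{v\}$ to $W$ and remove $\alpha$ from $F^i$ and $\alpha\cup\{v\}$ from $F^{i+1}$. *)

theory Defs
  imports "HOL-Library.Product_Lexorder" "HOL-Library.List_Lexorder"
begin

text \<open>
  A finite abstract simplicial complex is the set of its (nonempty) faces. Its vertices carry the
  order of their type; for columns \<open>(a, b) :: nat \<times> nat\<close> this is the lexicographic order from
  \<^theory>\<open>HOL-Library.Product_Lexorder\<close>.
\<close>

definition finite_complex :: "'v set set \<Rightarrow> bool" where
  "finite_complex K \<longleftrightarrow>
     finite K \<and> (\<forall>\<sigma>\<in>K. finite \<sigma> \<and> \<sigma> \<noteq> {}) \<and> (\<forall>\<sigma>\<in>K. \<forall>\<tau>. \<tau> \<noteq> {} \<and> \<tau> \<subseteq> \<sigma> \<longrightarrow> \<tau> \<in> K)"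

definition vertices :: "'v set set \<Rightarrow> 'v set" where
  "vertices K = \<Union>K"

definition faces :: "'v set set \<Rightarrow> nat \<Rightarrow> 'v set set" where
  "faces K i = {\<sigma> \<in> K. card \<sigma> = i + 1}"

definition dimension :: "'v set set \<Rightarrow> nat" where
  "dimension K = Max (card ` K) - 1"

text \<open>
  The increasing tuple \<open>[\<alpha>\<^sub>0, \<dots>, \<alpha>\<^sub>i]\<close> of a face is its \<^const>\<open>sorted_list_of_set\<close>. In \<open>lex_faces\<close>
  the outer \<^const>\<open>sorted_list_of_set\<close> sorts these tuples by the lexicographic order on lists from
  \<^theory>\<open>HOL-Library.List_Lexorder\<close>.
\<close>

definition lex_faces :: "('v::linorder) set set \<Rightarrow> nat \<Rightarrow> 'v set list" where
  "lex_faces K i = map set (sorted_list_of_set (sorted_list_of_set ` faces K i))"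

text \<open>
  The state of the algorithm consists of the set \<open>W\<close> of pairings found so far, a pairing
  \<open>\<alpha> \<nearrow> \<beta>\<close> being the pair \<open>(\<alpha>, \<beta>)\<close>, and of the sets \<open>F i\<close> of the \<open>i\<close>-faces that are still
  unpaired. Each of the following functions is the body of one of the four nested loops
  over \<open>\<alpha>\<close>, \<open>v\<close>, \<open>r\<close> and \<open>i\<close>, from the innermost to the outermost.
\<close>

type_synonym 'v state = "('v set \<times> 'v set) set \<times> (nat \<Rightarrow> 'v set set)"

definition step_face :: "('v::linorder) set set \<Rightarrow> nat \<Rightarrow> nat \<Rightarrow> 'v \<Rightarrow> 'v set \<Rightarrow> 'v state \<Rightarrow> 'v state"
  where
  "step_face K i r v \<alpha> = (\<lambda>(W, F).
     let \<beta> = insert v \<alpha> in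
     if v \<notin> \<alpha> \<and> \<beta> \<in> faces K (i + 1) \<and> sorted_list_of_set \<beta> ! r = v \<and> \<alpha> \<in> F i \<and> \<beta> \<in> F (i + 1)
     then (insert (\<alpha>, \<beta>) W, F(i := F i - {\<alpha>}, i + 1 := F (i + 1) - {\<beta>}))
     else (W, F))"

definition step_vertex :: "('v::linorder) set set \<Rightarrow> nat \<Rightarrow> nat \<Rightarrow> 'v \<Rightarrow> 'v state \<Rightarrow> 'v state" where
  "step_vertex K i r v = fold (step_face K i r v) (lex_faces K i)"

definition step_position :: "('v::linorder) set set \<Rightarrow> nat \<Rightarrow> nat \<Rightarrow> 'v state \<Rightarrow> 'v state" where
  "step_position K i r = fold (step_vertex K i r) (rev (sorted_list_of_set (vertices K)))"

definition step_dimension :: "('v::linorder) set set \<Rightarrow> nat \<Rightarrow> 'v state \<Rightarrow> 'v state" where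
  "step_dimension K i = (\<lambda>(W, F).
     if F i = {} \<or> F (i + 1) = {} then (W, F)
     else fold (step_position K i) (rev [0..<i + 2]) (W, F))"

definition algorithm_A :: "('v::linorder) set set \<Rightarrow> ('v set \<times> 'v set) set" where
  "algorithm_A K = fst (fold (step_dimension K) (rev [0..<dimension K]) ({}, faces K))"

definition critical_faces :: "'v set set \<Rightarrow> ('v set \<times> 'v set) set \<Rightarrow> nat \<Rightarrow> 'v set set" where
  "critical_faces K W k = {\<sigma> \<in> faces K k. \<forall>(\<alpha>, \<beta>) \<in> W. \<sigma> \<noteq> \<alpha> \<and> \<sigma> \<noteq> \<beta>}"

text \<open>
  An array with columns \<open>(a\<^sub>0, b\<^sub>0), \<dots>, (a\<^sub>k, b\<^sub>k)\<close> is the list of its columns. The predicate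
  \<open>face_array m\<close> collects the conditions under which an array displays a \<open>k\<close>-face of
  \<open>C\<^sub>m\<close>.
\<close>

definition face_array :: "nat \<Rightarrow> (nat \<times> nat) list \<Rightarrow> bool" where
  "face_array m xs \<longleftrightarrow>
     xs \<noteq> [] \<and> (\<forall>(a, b) \<in> set xs. a \<in> {1..m} \<and> b \<in> {1..m} \<and> a \<noteq> b) \<and>
     sorted (map fst xs) \<and> sorted (map snd xs) \<and> successively (\<noteq>) xs \<and>
     card (set (map fst xs)) \<le> 2 \<and> card (set (map snd xs)) \<le> 2"

definition munkres_complex :: "nat \<Rightarrow> (nat \<times> nat) set set" where
  "munkres_complex m = {set xs | xs. face_array m xs}"

definition W_field :: "nat \<Rightarrow> ((nat \<times> nat) set \<times> (nat \<times> nat) set) set" where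
  "W_field m = algorithm_A (munkres_complex m)"

text \<open>
  The columns of a face array are strictly increasing in the vertex order, so an array is
  the increasing tuple of the face that it displays.
\<close>

lemma face_array_sorted_wrt:
  assumes "face_array m xs"
  shows "sorted_wrt (<) xs"
proof -
  have "successively (<) xs"
    unfolding successively_conv_nth
  proof (intro allI impI)
    fix i assume i: "Suc i < length xs"
    have "fst (xs ! i) \<le> fst (xs ! Suc i)" "snd (xs ! i) \<le> snd (xs ! Suc i)"
      using assms i sorted_nth_mono[of "map fst xs" i "Suc i"] sorted_nth_mono[of "map snd xs" i "Suc i"]
      by (simp_all add: face_array_def)
    moreover have "xs ! i \<noteq> xs ! Suc i"
      using assms i unfolding face_array_def successively_conv_nth by auto
    ultimately show "xs ! i < xs ! Suc i"
      by (auto simp: less_prod_def prod_eq_iff)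
  qed
  then show ?thesis by (simp add: successively_iff_sorted_wrt_strong)
qed

lemma face_array_eq_tuple:
  assumes "face_array m xs"
  shows "sorted_list_of_set (set xs) = xs"
  using face_array_sorted_wrt[OF assms]
  by (simp add: sorted_list_of_set.idem_if_sorted_distinct strict_sorted_iff)

lemma finite_complex_munkres_complex: "finite_complex (munkres_complex m)"
proof -
  have "munkres_complex m \<subseteq> Pow ({1..m} \<times> {1..m})"
    by (fastforce simp: munkres_complex_def face_array_def)
  then have "finite (munkres_complex m)"
    by (rule finite_subset) simp
  moreover have "\<tau> \<in> munkres_complex m"
    if xs: "face_array m xs" and \<tau>: "\<tau> \<noteq> {}" "\<tau> \<subseteq> set xs" for xs \<tau>
  proof -
    define ys where "ys = filter (\<lambda>x. x \<in> \<tau>) xs"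
    have set_ys: "set ys = \<tau>" using \<tau> by (auto simp: ys_def)
    have "sorted_wrt (<) ys"
      using face_array_sorted_wrt[OF xs] by (simp add: ys_def sorted_wrt_filter)
    then have "sorted_wrt (\<noteq>) ys"
      by (rule sorted_wrt_mono_rel[rotated]) auto
    then have "successively (\<noteq>) ys"
      by (rule successively_if_sorted_wrt)
    moreover have "card (set (map f ys)) \<le> card (set (map f xs))" for f :: "nat \<times> nat \<Rightarrow> nat"
      by (rule card_mono) (auto simp: ys_def)
    then have "card (set (map fst ys)) \<le> 2" "card (set (map snd ys)) \<le> 2"
      using xs unfolding face_array_def by (meson order_trans)+
    moreover have "sorted (map fst ys)" "sorted (map snd ys)"
      using xs by (simp_all add: face_array_def ys_def sorted_filter)
    moreover have "ys \<noteq> []" "set ys \<subseteq> set xs"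
      using \<tau> set_ys by auto
    ultimately have "face_array m ys"
      using xs unfolding face_array_def by blast
    then show ?thesis
      using set_ys by (auto simp: munkres_complex_def)
  qed
  ultimately show ?thesis
    by (auto simp: finite_complex_def munkres_complex_def face_array_def)
qed

end

theory Submission
  imports Defs
begin

text \<open>
  The algorithm is a greedy matching. Its four nested loops run through the incidences
  \<open>(\<alpha>, \<alpha> \<union> {v})\<close> of the complex one after the other, and an incidence is turned into a pairing exactly
  when both of its faces are still free. Such a process is determined by a local property: a
  matching \<open>M\<close> is its output as soon as each incidence outside \<open>M\<close> shares a face with an element
  of \<open>M\<close> that was examined earlier (\<open>algorithm_A_eqI\<close>). The loops over the dimension \<open>i\<close>, the
  position \<open>r\<close> and the vertex \<open>v\<close> suffice to decide what is earlier, because two different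
  incidences with the same \<open>(i, r, v)\<close> have no face in common: either face determines the other.

  In \<open>C\<^sub>m\<close> a column \<open>(a, b)\<close> is a point of the grid, and a face is a strictly increasing chain of
  points inside a rectangle \<open>{a, c} \<times> {b, d}\<close>. Hence a triangle is one of the two staircases from
  \<open>(a, b)\<close> to \<open>(c, d)\<close>: the upper one passes through \<open>(a, d)\<close>, the lower one through \<open>(c, b)\<close>. An
  edge is vertical, horizontal or diagonal.

  Among triangles, position \<open>2\<close> is examined first. It is there that each vertical or horizontal
  edge takes the largest vertex that completes it to a triangle, namely one with the new
  coordinate \<open>m\<close>, or \<open>m - 1\<close> if \<open>m\<close> would create a column with equal entries. At position \<open>1\<close>
  a diagonal edge prefers the lower triangle, as \<open>(a, d) < (c, b)\<close>; if the
  lower one is no face or is used already, it takes the upper one unless that is used too. Everything at position \<open>0\<close> comes too late. Among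
  edges, position \<open>1\<close> joins each vertex to \<open>(m, m - 1)\<close> or, if its second entry is \<open>m\<close>, to
  \<open>(m - 1, m)\<close>. Only these two vertices themselves are left. Of them, \<open>(m - 1, m)\<close> finds a partner
  at position \<open>0\<close>, and \<open>(m, m - 1)\<close> stays critical.

  The lemmas \<open>gradient_pair_unique_coface\<close>, \<open>gradient_pair_unique_face\<close> and
  \<open>not_gradient_pair_chain\<close> say that these pairings form a matching, and
  \<open>blocked_if_not_gradient_pair\<close> finds for every other incidence the earlier pairing that
  excludes it; together they give \<open>W_field_eq\<close>. The critical faces are then read off from the
  list of pairings.
\<close>

section \<open>The algorithm as a greedy matching\<close>

definition candidate :: "('v::linorder) set set \<Rightarrow> nat \<Rightarrow> nat \<Rightarrow> 'v \<Rightarrow> 'v set \<Rightarrow> bool" where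
  "candidate K i r v \<alpha> \<longleftrightarrow> i < dimension K \<and> r < i + 2 \<and> \<alpha> \<in> faces K i \<and> v \<notin> \<alpha> \<and>
     insert v \<alpha> \<in> faces K (i + 1) \<and> sorted_list_of_set (insert v \<alpha>) ! r = v"

text \<open>
  The order of the three outer loops, each of which runs downwards. The face \<open>\<alpha>\<close> of the
  innermost loop is left out since incidences with equal \<open>(i, r, v)\<close> never compete for a face.
\<close>

fun precedes :: "nat \<times> nat \<times> 'v::linorder \<Rightarrow> nat \<times> nat \<times> 'v \<Rightarrow> bool" where
  "precedes (i, r, v) (i', r', v') \<longleftrightarrow> i' < i \<or> i = i' \<and> (r' < r \<or> r = r' \<and> v' < v)"

definition schedule :: "('v::linorder) set set \<Rightarrow> (nat \<times> nat \<times> 'v \<times> 'v set) list" where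
  "schedule K = [(i, r, v, \<alpha>). i \<leftarrow> rev [0..<dimension K], r \<leftarrow> rev [0..<i + 2],
     v \<leftarrow> rev (sorted_list_of_set (vertices K)), \<alpha> \<leftarrow> lex_faces K i]"

lemma fold_concat_map: "fold f (concat (map g xs)) = fold (\<lambda>x. fold f (g x)) xs"
  by (induction xs) auto

lemma fold_eq_self:
  assumes "\<And>x. x \<in> set xs \<Longrightarrow> f x s = s"
  shows "fold f xs s = s"
  using assms by (induction xs) auto

text \<open>
  Skipping a dimension changes nothing: if one of the two sets of free faces is empty, no step
  of that dimension can find a pair.
\<close>

lemma step_dimension_eq_fold:
  "step_dimension K i s = fold (step_position K i) (rev [0..<i + 2]) s"
proof (cases s)
  case (Pair W F)
  have "fold (step_position K i) (rev [0..<i + 2]) (W, F) = (W, F)" if "F i = {} \<or> F (i + 1) = {}"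
    unfolding step_position_def step_vertex_def
    using that by (intro fold_eq_self) (auto simp: step_face_def Let_def)
  then show ?thesis
    unfolding Pair step_dimension_def by simp
qed

lemma algorithm_A_eq_fold_schedule:
  "algorithm_A K = fst (fold (\<lambda>(i, r, v, \<alpha>). step_face K i r v \<alpha>) (schedule K) ({}, faces K))"
proof -
  have "step_dimension K = (\<lambda>i. fold (step_position K i) (rev [0..<i + 2]))"
    by (intro ext step_dimension_eq_fold)
  moreover have "step_position K = (\<lambda>i r.
      fold (\<lambda>v. fold (step_face K i r v) (lex_faces K i))
      (rev (sorted_list_of_set (vertices K))))"
    by (intro ext) (simp add: step_position_def step_vertex_def[abs_def])
  ultimately show ?thesis
    by (simp add: algorithm_A_def schedule_def fold_concat_map fold_map comp_def del: upt_Suc)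
qed

lemma sorted_wrt_concat_map:
  assumes "sorted_wrt P xs" and "\<And>x. x \<in> set xs \<Longrightarrow> sorted_wrt Q (g x)"
    and "\<And>x y a b. P x y \<Longrightarrow> a \<in> set (g x) \<Longrightarrow> b \<in> set (g y) \<Longrightarrow> Q a b"
  shows "sorted_wrt Q (concat (map g xs))"
  using assms(1,2) by (induction xs) (auto simp: sorted_wrt_append intro: assms(3))

definition key :: "nat \<times> nat \<times> 'v \<times> 'v set \<Rightarrow> nat \<times> nat \<times> 'v" where
  "key = (\<lambda>(i, r, v, \<alpha>). (i, r, v))"

text \<open>
  The negated form lets items with the same key stand in any order, while still placing an item
  that precedes another one in front of it.
\<close>

lemma schedule_sorted: "sorted_wrt (\<lambda>x y. \<not> precedes (key y) (key x)) (schedule K)"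
proof -
  have down: "sorted_wrt (>) (rev [0..<n])" for n :: nat
    by (simp add: sorted_wrt_rev)
  have down_V: "sorted_wrt (>) (rev (sorted_list_of_set (vertices K)))"
    by (simp add: sorted_wrt_rev)
  show ?thesis
    unfolding schedule_def
    by (intro sorted_wrt_concat_map[OF down] sorted_wrt_concat_map[OF down_V])
      (auto simp: sorted_wrt_map key_def sorted_wrt_iff_nth_less)
qed

lemma set_lex_faces:
  assumes "finite_complex K"
  shows "set (lex_faces K i) = faces K i"
proof -
  have "finite (faces K i)" "\<forall>\<sigma>\<in>faces K i. finite \<sigma>"
    using assms by (auto simp: finite_complex_def faces_def)
  then show ?thesis
    by (simp add: lex_faces_def image_image)
qed

lemma set_schedule:
  assumes "finite_complex K"
  shows "(i, r, v, \<alpha>) \<in> set (schedule K) \<longleftrightarrow>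
    i < dimension K \<and> r < i + 2 \<and> v \<in> vertices K \<and> \<alpha> \<in> faces K i"
proof -
  have "finite (vertices K)"
    using assms by (auto simp: finite_complex_def vertices_def)
  then show ?thesis
    unfolding schedule_def by (simp add: set_lex_faces[OF assms] image_iff del: upt_Suc)
qed

lemma candidate_in_schedule:
  assumes "finite_complex K" "candidate K i r v \<alpha>"
  shows "(i, r, v, \<alpha>) \<in> set (schedule K)"
  using assms(2) by (auto simp: set_schedule[OF assms(1)] candidate_def vertices_def faces_def)

definition unmatched :: "('v set \<times> 'v set) set \<Rightarrow> 'v set set \<Rightarrow> 'v set set" where
  "unmatched W A = {\<sigma> \<in> A. \<forall>(\<alpha>, \<beta>) \<in> W. \<sigma> \<noteq> \<alpha> \<and> \<sigma> \<noteq> \<beta>}"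

text \<open>
  After each initial part of the schedule, the pairings found are exactly the elements of \<open>M\<close> that
  occurred in it. Indeed, an element of \<open>M\<close> finds both faces free because \<open>M\<close> is a matching, and
  for an incidence outside \<open>M\<close> the hypothesis \<open>blocked\<close> provides an earlier element of \<open>M\<close>, hence
  one that was already added, which occupies one of its faces.
\<close>

lemma algorithm_A_eqI:
  fixes K :: "('v::linorder) set set"
  assumes K: "finite_complex K"
    and cand: "\<And>\<alpha> \<beta>. (\<alpha>, \<beta>) \<in> M \<Longrightarrow> \<exists>i r v. candidate K i r v \<alpha> \<and> \<beta> = insert v \<alpha>"
    and disj: "\<And>\<alpha> \<beta> \<alpha>' \<beta>'. (\<alpha>, \<beta>) \<in> M \<Longrightarrow> (\<alpha>', \<beta>') \<in> M \<Longrightarrow> (\<alpha>, \<beta>) \<noteq> (\<alpha>', \<beta>') \<Longrightarrow>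
      {\<alpha>, \<beta>} \<inter> {\<alpha>', \<beta>'} = {}"
    and blocked: "\<And>i r v \<alpha>. candidate K i r v \<alpha> \<Longrightarrow> (\<alpha>, insert v \<alpha>) \<notin> M \<Longrightarrow>
      \<exists>i' r' v' \<alpha>'. candidate K i' r' v' \<alpha>' \<and> (\<alpha>', insert v' \<alpha>') \<in> M \<and>
        precedes (i', r', v') (i, r, v) \<and> {\<alpha>, insert v \<alpha>} \<inter> {\<alpha>', insert v' \<alpha>'} \<noteq> {}"
  shows "algorithm_A K = M"
proof -
  define edge :: "nat \<times> nat \<times> 'v \<times> 'v set \<Rightarrow> 'v set \<times> 'v set"
    where "edge = (\<lambda>(i, r, v, \<alpha>). (\<alpha>, insert v \<alpha>))"
  define chosen where "chosen xs = {edge (i, r, v, \<alpha>) | i r v \<alpha>.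
      (i, r, v, \<alpha>) \<in> set xs \<and> candidate K i r v \<alpha> \<and> edge (i, r, v, \<alpha>) \<in> M}" for xs
  let ?step = "\<lambda>(i, r, v, \<alpha>). step_face K i r v \<alpha>"
  have sched: "i < dimension K \<and> r < i + 2 \<and> \<alpha> \<in> faces K i"
    if "(i, r, v, \<alpha>) \<in> set (schedule K)" for i r v \<alpha>
    using that by (simp add: set_schedule[OF K])
  have "fold ?step xs ({}, faces K) = (chosen xs, \<lambda>k. unmatched (chosen xs) (faces K k))"
    if "schedule K = xs @ ys" for xs ys
    using that
  proof (induction xs arbitrary: ys rule: rev_induct)
    case Nil
    then show ?case by (simp add: chosen_def unmatched_def)
  next
    case (snoc x xs)
    obtain i r v \<alpha> where x: "x = (i, r, v, \<alpha>)" by (cases x)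
    have IH: "fold ?step xs ({}, faces K) = (chosen xs, \<lambda>k. unmatched (chosen xs) (faces K k))"
      using snoc.IH[of "x # ys"] snoc.prems by simp
    have sub: "chosen xs \<subseteq> M" by (auto simp: chosen_def)
    have sx: "i < dimension K \<and> r < i + 2 \<and> \<alpha> \<in> faces K i"
      using sched snoc.prems x by auto
    have chosen_snoc: "chosen (xs @ [x]) =
      (if candidate K i r v \<alpha> \<and> (\<alpha>, insert v \<alpha>) \<in> M then insert (\<alpha>, insert v \<alpha>) (chosen xs) else chosen xs)"
      by (auto simp: chosen_def x edge_def)
    let ?\<beta> = "insert v \<alpha>"
    show ?case
    proof (cases "candidate K i r v \<alpha> \<and> \<alpha> \<in> unmatched (chosen xs) (faces K i) \<and>
        ?\<beta> \<in> unmatched (chosen xs) (faces K (i + 1))")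
      case True
      have "(\<alpha>, ?\<beta>) \<in> M"
      proof (rule ccontr)
        assume "(\<alpha>, ?\<beta>) \<notin> M"
        then obtain i' r' v' \<alpha>' where b: "candidate K i' r' v' \<alpha>'" "(\<alpha>', insert v' \<alpha>') \<in> M"
          "precedes (i', r', v') (i, r, v)" "{\<alpha>, ?\<beta>} \<inter> {\<alpha>', insert v' \<alpha>'} \<noteq> {}"
          using blocked[of i r v \<alpha>] True by blast
        \<comment> \<open>The blocking item lies in the schedule, but by sortedness not after \<open>x\<close>.\<close>
        have "(i', r', v', \<alpha>') \<in> set (xs @ [x] @ ys)"
          using candidate_in_schedule[OF K b(1)] snoc.prems by simp
        moreover have "(i', r', v', \<alpha>') \<noteq> x" using b(3) x by auto
        moreover have "(i', r', v', \<alpha>') \<notin> set ys"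
          using schedule_sorted[of K] b(3) unfolding snoc.prems
          by (auto simp: sorted_wrt_append x key_def)
        ultimately have "(\<alpha>', insert v' \<alpha>') \<in> chosen xs"
          using b by (auto simp: chosen_def edge_def)
        then show False using b(4) True by (auto simp: unmatched_def)
      qed
      then have "chosen (xs @ [x]) = insert (\<alpha>, ?\<beta>) (chosen xs)"
        using True by (simp add: chosen_snoc)
      moreover have "\<alpha> \<notin> faces K k" if "k \<noteq> i" for k
        using sx that by (auto simp: faces_def)
      moreover have "?\<beta> \<notin> faces K k" if "k \<noteq> i + 1" for k
        using True that by (auto simp: faces_def candidate_def)
      ultimately have "(\<lambda>k. unmatched (chosen xs) (faces K k))
          (i := unmatched (chosen xs) (faces K i) - {\<alpha>},
           i + 1 := unmatched (chosen xs) (faces K (i + 1)) - {?\<beta>}) =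
          (\<lambda>k. unmatched (chosen (xs @ [x])) (faces K k))"
        by (auto simp: fun_eq_iff unmatched_def)
      then show ?thesis
        using IH True \<open>chosen (xs @ [x]) = insert (\<alpha>, ?\<beta>) (chosen xs)\<close>
        by (simp add: x step_face_def candidate_def Let_def)
    next
      case False
      \<comment> \<open>An element of \<open>M\<close> can only be refused because it was added before: as \<open>M\<close> is a
        matching, whatever occupies one of its faces is the element itself.\<close>
      have "chosen (xs @ [x]) = chosen xs"
      proof (cases "candidate K i r v \<alpha> \<and> (\<alpha>, ?\<beta>) \<in> M")
        case c: True
        then obtain \<alpha>' \<beta>' where e: "(\<alpha>', \<beta>') \<in> chosen xs" "{\<alpha>, ?\<beta>} \<inter> {\<alpha>', \<beta>'} \<noteq> {}"
          using False by (auto simp: unmatched_def candidate_def)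
        then have "(\<alpha>, ?\<beta>) = (\<alpha>', \<beta>')"
          using disj[of \<alpha> ?\<beta> \<alpha>' \<beta>'] c sub by blast
        then show ?thesis using e c by (auto simp: chosen_snoc)
      qed (auto simp: chosen_snoc)
      then show ?thesis
        using IH False sx by (auto simp: x step_face_def candidate_def)
    qed
  qed
  from this[of "schedule K" "[]"] have "algorithm_A K = chosen (schedule K)"
    by (simp add: algorithm_A_eq_fold_schedule)
  also have "\<dots> = M"
  proof
    show "M \<subseteq> chosen (schedule K)"
      using cand candidate_in_schedule[OF K] by (fastforce simp: chosen_def edge_def)
  qed (auto simp: chosen_def)
  finally show ?thesis .
qed

section \<open>Faces and incidences of \<open>C\<^sub>m\<close>\<close>

lemma card_le_2_no_three:
  fixes x y z :: "'a::linorder"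
  assumes "card (set xs) \<le> 2" "x \<in> set xs" "y \<in> set xs" "z \<in> set xs" "x < y" "y < z"
  shows False
proof -
  have "card {x, y, z} \<le> card (set xs)"
    using assms by (intro card_mono) auto
  moreover have "x \<noteq> y" "x \<noteq> z" "y \<noteq> z"
    using assms(5,6) by auto
  ultimately show False
    using assms(1) by simp
qed

lemma face_array_vertex:
  "face_array m [(a, b)] \<longleftrightarrow> a \<in> {1..m} \<and> b \<in> {1..m} \<and> a \<noteq> b"
  by (simp add: face_array_def)

lemma face_array_edge:
  "face_array m [(a, b), (c, d)] \<longleftrightarrow> face_array m [(a, b)] \<and> face_array m [(c, d)] \<and>
     a \<le> c \<and> b \<le> d \<and> (a, b) \<noteq> (c, d)"
  by (auto simp: face_array_def card_insert_if)

lemma face_array_triangle: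
  "face_array m [(a, b), (c, d), (e, f)] \<longleftrightarrow>
     face_array m [(a, b)] \<and> face_array m [(c, d)] \<and> face_array m [(e, f)] \<and> a < e \<and> b < f \<and>
     (c = a \<and> d = f \<or> c = e \<and> d = b)"
  by (auto simp: face_array_def card_insert_if split: if_splits)

lemmas face_array_simps = face_array_vertex face_array_edge face_array_triangle

text \<open>
  Each of the steps of a face array raises the first or the second entry, and an entry can be
  raised only once as it takes at most two values.
\<close>

lemma face_array_length_le_3:
  assumes "face_array m xs"
  shows "length xs \<le> 3"
proof (rule ccontr)
  assume "\<not> length xs \<le> 3"
  then obtain a b c d e f g h ys where xs: "xs = (a, b) # (c, d) # (e, f) # (g, h) # ys"
    by (fastforce simp: not_le less_eq_Suc_le numeral_3_eq_3 Suc_le_length_iff)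
  have "a \<le> c" "c \<le> e" "e \<le> g" "b \<le> d" "d \<le> f" "f \<le> h"
    and "(a, b) \<noteq> (c, d)" "(c, d) \<noteq> (e, f)" "(e, f) \<noteq> (g, h)"
    using assms by (auto simp: face_array_def xs)
  moreover have "\<not> (x < y \<and> y < z)" if "{x, y, z} \<subseteq> {a, c, e, g}" for x y z
    using assms that card_le_2_no_three[of "map fst xs" x y z]
    by (auto simp: face_array_def xs)
  then have "\<not> (a < c \<and> c < e)" "\<not> (a < c \<and> c < g)" "\<not> (c < e \<and> e < g)" "\<not> (a < e \<and> e < g)"
    by auto
  moreover have "\<not> (x < y \<and> y < z)" if "{x, y, z} \<subseteq> {b, d, f, h}" for x y z
    using assms that card_le_2_no_three[of "map snd xs" x y z]
    by (auto simp: face_array_def xs)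
  then have "\<not> (b < d \<and> d < f)" "\<not> (b < d \<and> d < h)" "\<not> (d < f \<and> f < h)" "\<not> (b < f \<and> f < h)"
    by auto
  ultimately show False by auto
qed

lemma distinct_face_array: "face_array m xs \<Longrightarrow> distinct xs"
  using face_array_sorted_wrt strict_sorted_iff by blast

lemma face_array_eqI: "face_array m xs \<Longrightarrow> face_array m ys \<Longrightarrow> set xs = set ys \<Longrightarrow> xs = ys"
  by (metis face_array_eq_tuple)

lemma set_in_munkres_complex: "face_array m xs \<Longrightarrow> set xs \<in> munkres_complex m"
  by (auto simp: munkres_complex_def)

lemma faces_munkres_complex:
  "faces (munkres_complex m) k = {set xs | xs. face_array m xs \<and> length xs = k + 1}"
  by (auto simp: faces_def munkres_complex_def distinct_card distinct_face_array)

lemma dimension_munkres_complex: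
  assumes "m \<ge> 3"
  shows "dimension (munkres_complex m) = 2"
proof -
  have fin: "finite (munkres_complex m)"
    using finite_complex_munkres_complex by (simp add: finite_complex_def)
  have "face_array m [(1, 2), (1, 3), (2, 3)]"
    using assms by (simp add: face_array_simps)
  then have "3 \<in> card ` munkres_complex m"
    by (force dest: set_in_munkres_complex)
  moreover have "n \<le> 3" if "n \<in> card ` munkres_complex m" for n
    using that face_array_length_le_3
    by (auto simp: munkres_complex_def distinct_card distinct_face_array)
  ultimately have "Max (card ` munkres_complex m) = 3"
    using fin by (intro Max_eqI) auto
  then show ?thesis by (simp add: dimension_def)
qed

definition delete_at :: "nat \<Rightarrow> 'a list \<Rightarrow> 'a list" where
  "delete_at r xs = take r xs @ drop (Suc r) xs"

lemma set_delete_at: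
  assumes "distinct xs" "r < length xs"
  shows "set (delete_at r xs) = set xs - {xs ! r}"
proof -
  have "distinct (take r xs @ xs ! r # drop (Suc r) xs)"
    using assms by (simp add: id_take_nth_drop[symmetric])
  moreover have "set xs = set (take r xs @ xs ! r # drop (Suc r) xs)"
    using assms by (simp add: id_take_nth_drop[symmetric])
  ultimately show ?thesis
    by (auto simp: delete_at_def)
qed

text \<open>
  On arrays, the incidences of codimension one are given by deleting the column in position \<open>r\<close>;
  as an array is the increasing tuple of its face, this is the position that the algorithm uses.
\<close>

lemma candidate_munkres_complex:
  assumes "m \<ge> 3"
  shows "candidate (munkres_complex m) i r v \<alpha> \<longleftrightarrow> i < 2 \<and> r < i + 2 \<and>
    (\<exists>ys. face_array m ys \<and> length ys = i + 2 \<and> v = ys ! r \<and> \<alpha> = set (delete_at r ys))"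
    (is "?L \<longleftrightarrow> ?R")
proof
  assume c: ?L
  then have "insert v \<alpha> \<in> faces (munkres_complex m) (i + 1)"
    by (simp add: candidate_def)
  then obtain ys where ys: "face_array m ys" "length ys = i + 2" "insert v \<alpha> = set ys"
    by (auto simp: faces_munkres_complex)
  then have "v = ys ! r"
    using c face_array_eq_tuple[OF ys(1)] by (simp add: candidate_def)
  moreover have "r < i + 2" "i < 2" "v \<notin> \<alpha>"
    using c by (auto simp: candidate_def dimension_munkres_complex assms)
  ultimately show ?R
    using ys set_delete_at[OF distinct_face_array[OF ys(1)], of r] by fastforce
next
  assume ?R
  then obtain ys where ys: "i < 2" "r < i + 2" "face_array m ys" "length ys = i + 2"
    "v = ys ! r" "\<alpha> = set (delete_at r ys)" by blast
  have \<alpha>: "\<alpha> = set ys - {v}" and v: "v \<in> set ys"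
    using ys set_delete_at[OF distinct_face_array[OF ys(3)]] by auto
  have card: "card (set ys) = i + 2"
    using ys(3,4) by (simp add: distinct_card distinct_face_array)
  then have card': "card \<alpha> = i + 1"
    using \<alpha> v by simp
  then have "\<alpha> \<noteq> {}" by auto
  then have "\<alpha> \<in> munkres_complex m"
    using finite_complex_munkres_complex set_in_munkres_complex[OF ys(3)] \<alpha>
    unfolding finite_complex_def by (metis Diff_subset)
  moreover have "insert v \<alpha> = set ys" using \<alpha> v by auto
  ultimately show ?L
    using ys(1,2) card card' \<alpha> face_array_eq_tuple[OF ys(3)] ys(5) set_in_munkres_complex[OF ys(3)]
    by (simp add: candidate_def faces_def dimension_munkres_complex assms)
qed

section \<open>The pairings form a matching\<close>

definition gradient_pair :: "nat \<Rightarrow> (nat \<times> nat) list \<Rightarrow> (nat \<times> nat) list \<Rightarrow> bool" where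
  "gradient_pair m xs ys \<longleftrightarrow> face_array m xs \<and> face_array m ys \<and>
       ((\<exists>a b d. xs = [(a, b), (a, d)] \<and> ys = [(a, b), (a, d), (m, d)] \<and> a < m \<and> m > d) \<or>
        (\<exists>a b. xs = [(a, b), (a, m)] \<and> ys = [(a, b), (a, m), (m - 1, m)] \<and> a < m - 1) \<or>
        (\<exists>a b c. xs = [(a, b), (c, b)] \<and> ys = [(a, b), (c, b), (c, m)] \<and> b < m \<and> m > c) \<or>
        (\<exists>a b. xs = [(a, b), (m, b)] \<and> ys = [(a, b), (m, b), (m, m - 1)] \<and> b < m - 1) \<or>
        (\<exists>a b c d. xs = [(a, b), (c, d)] \<and> ys = [(a, b), (c, b), (c, d)] \<and>
           a < c \<and> b < d \<and> b \<noteq> c \<and> (c < m \<and> m > d \<or> c = m \<and> m > d + 1)) \<or>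
        (\<exists>a b c d. xs = [(a, b), (c, d)] \<and> ys = [(a, b), (a, d), (c, d)] \<and>
           a < c \<and> b < d \<and> a \<noteq> d \<and> (b = c \<and> c < m \<and> m > d \<or> c + 1 < m \<and> m = d)) \<or>
        (\<exists>a b. xs = [(a, b)] \<and> ys = [(a, b), (m, m - 1)] \<and>
           (b < m - 1 \<or> a < m - 1 \<and> m - 1 = b)) \<or>
        (\<exists>a. xs = [(a, m)] \<and> ys = [(a, m), (m - 1, m)] \<and> a < m - 1) \<or>
        (xs = [(m - 1, m)] \<and> ys = [(m - 1, m - 2), (m - 1, m)]))"

lemma gradient_pair_face_array:
  assumes "gradient_pair m xs ys"
  shows "face_array m xs" "face_array m ys"
  using assms by (simp_all add: gradient_pair_def)

lemma gradient_pair_delete_at: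
  assumes "gradient_pair m xs ys"
  obtains r where "xs = delete_at r ys" "r < length ys" "length ys = 2 \<or> length ys = 3"
proof -
  have "\<exists>r \<in> {0, 1, 2}. xs = delete_at r ys \<and> r < length ys \<and> (length ys = 2 \<or> length ys = 3)"
    using assms unfolding gradient_pair_def delete_at_def by auto
  then show ?thesis using that by blast
qed

text \<open>
  A face is paired upwards at most once: for vertical and horizontal edges the value \<open>m\<close> or
  \<open>m - 1\<close> of the new entry is forced by the edge, and for diagonal edges the lower and the upper
  triangle are chosen under exclusive conditions. A vertex has the partner \<open>(m, m - 1)\<close> if its second
  entry is below \<open>m\<close>; otherwise it has \<open>(m - 1, m)\<close>, unless it is that vertex itself.
\<close>

lemma gradient_pair_unique_coface:
  assumes "gradient_pair m xs ys" "gradient_pair m xs zs"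
  shows "ys = zs"
  using assms unfolding gradient_pair_def by (auto simp: face_array_simps)

text \<open>
  A triangle that is paired with its vertical or horizontal first edge has \<open>m\<close> or \<open>m - 1\<close> in the
  entries that the condition for its diagonal edge excludes. An edge is paired with its smaller
  vertex, except that a vertical edge ending in \<open>(m - 1, m)\<close> can only be paired with that vertex.
\<close>

lemma gradient_pair_unique_face:
  assumes "gradient_pair m xs zs" "gradient_pair m ys zs"
  shows "xs = ys"
  using assms unfolding gradient_pair_def by (auto simp: face_array_simps)

text \<open>
  The edges that are paired with vertices end in \<open>(m, m - 1)\<close> or \<open>(m - 1, m)\<close>. Vertical and
  horizontal edges of this kind are not the first edge of any triangle, and the only diagonal ones
  end in \<open>(m, m - 1)\<close>, which the conditions for pairing a diagonal edge with a triangle exclude.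
\<close>

lemma not_gradient_pair_chain:
  assumes "gradient_pair m xs ys" "gradient_pair m ys zs"
  shows False
  using assms unfolding gradient_pair_def by (auto simp: face_array_simps)

text \<open>
  The following rules create pairings. They are stated for arrays with arbitrary entries that are
  then fixed by equations, so that they apply to the incidence at hand without rewriting it first;
  the remaining side conditions of the pairings follow from the shape of a face array.
\<close>

lemma gradient_pair_vertical:
  assumes "face_array m [(a, b), (a, d), (c, d)]" "c = m"
  shows "gradient_pair m [(a, b), (a, d)] [(a, b), (a, d), (c, d)]"
  using assms by (auto simp: gradient_pair_def face_array_simps)

lemma gradient_pair_vertical_top:
  assumes "face_array m [(a, b), (a, d), (c, d)]" "d = m" "c = m - 1"
  shows "gradient_pair m [(a, b), (a, d)] [(a, b), (a, d), (c, d)]"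
  using assms by (auto simp: gradient_pair_def face_array_simps)

lemma gradient_pair_horizontal:
  assumes "face_array m [(a, b), (c, b), (c, d)]" "d = m"
  shows "gradient_pair m [(a, b), (c, b)] [(a, b), (c, b), (c, d)]"
  using assms by (auto simp: gradient_pair_def face_array_simps)

lemma gradient_pair_horizontal_right:
  assumes "face_array m [(a, b), (c, b), (c, d)]" "c = m" "d = m - 1"
  shows "gradient_pair m [(a, b), (c, b)] [(a, b), (c, b), (c, d)]"
  using assms by (auto simp: gradient_pair_def face_array_simps)

lemma gradient_pair_diagonal_lower:
  assumes "face_array m [(a, b), (c, b), (c, d)]" "c < m \<and> d < m \<or> c = m \<and> d < m - 1"
  shows "gradient_pair m [(a, b), (c, d)] [(a, b), (c, b), (c, d)]"
  using assms by (auto simp: gradient_pair_def face_array_simps)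

lemma gradient_pair_diagonal_upper:
  assumes "face_array m [(a, b), (a, d), (c, d)]" "b = c \<and> c < m \<and> d < m \<or> d = m \<and> c < m - 1"
  shows "gradient_pair m [(a, b), (c, d)] [(a, b), (a, d), (c, d)]"
  using assms by (auto simp: gradient_pair_def face_array_simps)

lemma gradient_pair_vertex:
  assumes "face_array m [(a, b), (c, d)]" "c = m" "d = m - 1"
  shows "gradient_pair m [(a, b)] [(a, b), (c, d)]"
  using assms by (auto simp: gradient_pair_def face_array_simps)

lemma gradient_pair_vertex_top:
  assumes "face_array m [(a, b), (c, d)]" "c = m - 1" "b = m"
  shows "gradient_pair m [(a, b)] [(a, b), (c, d)]"
  using assms by (auto simp: gradient_pair_def face_array_simps)

lemma gradient_pair_vertex_last:
  assumes "face_array m [(a, b), (c, d)]" "a = m - 1" "b = m - 2" "c = m - 1" "d = m"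
  shows "gradient_pair m [(c, d)] [(a, b), (c, d)]"
  using assms by (auto simp: gradient_pair_def face_array_simps)

section \<open>Every other incidence is blocked\<close>

text \<open>
  An earlier pairing excludes the incidence of \<open>ys\<close> and its face without column \<open>r\<close>. The
  competing pairing always has the same dimension here and shares either the smaller or the
  larger face, never the smaller face of one with the larger face of the other.
\<close>

definition blocked :: "nat \<Rightarrow> (nat \<times> nat) list \<Rightarrow> nat \<Rightarrow> bool" where
  "blocked m ys r \<longleftrightarrow> (\<exists>ys' r'. gradient_pair m (delete_at r' ys') ys' \<and> length ys' = length ys \<and>
     r' < length ys \<and> (r < r' \<or> r = r' \<and> ys ! r < ys' ! r') \<and>
     (delete_at r' ys' = delete_at r ys \<or> ys' = ys))"

text \<open>
  At the same position, the smaller face prefers the pairing with the larger new vertex. The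
  comparison of the vertices may use \<open>ys' \<noteq> ys\<close> because the second assumption makes the two
  larger faces different.
\<close>

lemma blocked_by_face:
  assumes "gradient_pair m (delete_at r ys) ys'" "\<not> gradient_pair m (delete_at r ys) ys"
    "delete_at r ys' = delete_at r ys" "length ys' = length ys" "r < length ys"
    "ys' \<noteq> ys \<Longrightarrow> ys ! r < ys' ! r"
  shows "blocked m ys r"
  using assms unfolding blocked_def by metis

lemma blocked_by_later_face:
  assumes "gradient_pair m (delete_at r ys) ys'" "delete_at r' ys' = delete_at r ys"
    "length ys' = length ys" "r < r'" "r' < length ys"
  shows "blocked m ys r"
  using assms unfolding blocked_def by metis

lemma blocked_by_coface:
  assumes "gradient_pair m (delete_at r' ys) ys" "r < r'" "r' < length ys"
  shows "blocked m ys r"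
  using assms unfolding blocked_def by blast

text \<open>
  Position \<open>2\<close>: the vertical edge is paired with the largest possible \<open>c\<close>, which is \<open>m - 1\<close> if
  \<open>d = m\<close> and \<open>m\<close> otherwise. For the horizontal edge of a lower triangle, the two entries of the
  columns exchange their roles.
\<close>

lemma blocked_upper_2:
  assumes "m \<ge> 4" "face_array m [(a, b), (a, d), (c, d)]"
    "\<not> gradient_pair m [(a, b), (a, d)] [(a, b), (a, d), (c, d)]"
  shows "blocked m [(a, b), (a, d), (c, d)] 2"
proof (cases "d = m")
  case True
  then have "gradient_pair m [(a, b), (a, d)] [(a, b), (a, d), (m - 1, d)]"
    using assms(1,2) by (intro gradient_pair_vertical_top) (auto simp: face_array_simps)
  then show ?thesis
    using assms True
    by (intro blocked_by_face[where ys' = "[(a, b), (a, d), (m - 1, d)]"])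
      (auto simp: delete_at_def face_array_simps)
next
  case False
  then have "gradient_pair m [(a, b), (a, d)] [(a, b), (a, d), (m, d)]"
    using assms(1,2) by (intro gradient_pair_vertical) (auto simp: face_array_simps)
  then show ?thesis
    using assms False
    by (intro blocked_by_face[where ys' = "[(a, b), (a, d), (m, d)]"])
      (auto simp: delete_at_def face_array_simps)
qed

lemma blocked_lower_2:
  assumes "m \<ge> 4" "face_array m [(a, b), (c, b), (c, d)]"
    "\<not> gradient_pair m [(a, b), (c, b)] [(a, b), (c, b), (c, d)]"
  shows "blocked m [(a, b), (c, b), (c, d)] 2"
proof (cases "c = m")
  case True
  then have "gradient_pair m [(a, b), (c, b)] [(a, b), (c, b), (c, m - 1)]"
    using assms(1,2) by (intro gradient_pair_horizontal_right) (auto simp: face_array_simps)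
  then show ?thesis
    using assms True
    by (intro blocked_by_face[where ys' = "[(a, b), (c, b), (c, m - 1)]"])
      (auto simp: delete_at_def face_array_simps)
next
  case False
  then have "gradient_pair m [(a, b), (c, b)] [(a, b), (c, b), (c, m)]"
    using assms(1,2) by (intro gradient_pair_horizontal) (auto simp: face_array_simps)
  then show ?thesis
    using assms False
    by (intro blocked_by_face[where ys' = "[(a, b), (c, b), (c, m)]"])
      (auto simp: delete_at_def face_array_simps)
qed

text \<open>
  Position \<open>1\<close>, first choice: among the candidates for a diagonal edge the vertex \<open>(c, b)\<close> of the
  lower triangle is the largest, so the incidence can only fail because the triangle was used at
  position \<open>2\<close>.
\<close>

lemma blocked_lower_1:
  assumes "face_array m [(a, b), (c, b), (c, d)]"
    "\<not> gradient_pair m [(a, b), (c, d)] [(a, b), (c, b), (c, d)]"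
  shows "blocked m [(a, b), (c, b), (c, d)] 1"
proof -
  have "d = m \<or> c = m \<and> d = m - 1"
    using gradient_pair_diagonal_lower[OF assms(1)] assms by (fastforce simp: face_array_simps)
  then have "gradient_pair m [(a, b), (c, b)] [(a, b), (c, b), (c, d)]"
    using assms(1) gradient_pair_horizontal gradient_pair_horizontal_right by blast
  then show ?thesis
    by (intro blocked_by_coface[where r' = 2]) (auto simp: delete_at_def)
qed

text \<open>
  Position \<open>1\<close>, second choice: if the upper triangle was not used at position \<open>2\<close>, then the diagonal
  edge has already been paired with the lower triangle.
\<close>

lemma blocked_upper_1:
  assumes "face_array m [(a, b), (a, d), (c, d)]"
    "\<not> gradient_pair m [(a, b), (c, d)] [(a, b), (a, d), (c, d)]"
  shows "blocked m [(a, b), (a, d), (c, d)] 1"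
proof (cases "c < m \<and> d < m")
  case True
  then have "gradient_pair m [(a, b), (c, d)] [(a, b), (c, b), (c, d)]"
    using assms gradient_pair_diagonal_upper[OF assms(1)]
    by (intro gradient_pair_diagonal_lower) (auto simp: face_array_simps)
  then show ?thesis
    using assms
    by (intro blocked_by_face[where ys' = "[(a, b), (c, b), (c, d)]"])
      (auto simp: delete_at_def face_array_simps)
next
  case False
  then have "c = m \<or> d = m \<and> c = m - 1"
    using gradient_pair_diagonal_upper[OF assms(1)] assms by (fastforce simp: face_array_simps)
  then have "gradient_pair m [(a, b), (a, d)] [(a, b), (a, d), (c, d)]"
    using assms(1) gradient_pair_vertical gradient_pair_vertical_top by blast
  then show ?thesis
    by (intro blocked_by_coface[where r' = 2]) (auto simp: delete_at_def)
qed

text \<open>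
  Position \<open>0\<close> comes too late: the edge left after deleting the first column is horizontal, so
  that it was paired at position \<open>2\<close> unless it cannot be extended there. In that case \<open>d = m\<close> or
  \<open>(c, d) = (m, m - 1)\<close>, and the triangle itself was used at position \<open>2\<close> or \<open>1\<close>. Lower triangles,
  which leave a vertical edge, are treated in the same way.
\<close>

lemma blocked_upper_0:
  assumes "m \<ge> 4" "face_array m [(a, b), (a, d), (c, d)]"
  shows "blocked m [(a, b), (a, d), (c, d)] 0"
proof -
  consider "d < m" "c < m" | "c = m" "d < m - 1" | "d = m \<and> c = m - 1 \<or> c = m \<and> d = m - 1"
    | "d = m" "c < m - 1"
    using assms by (fastforce simp: face_array_simps)
  then show ?thesis
  proof cases
    case 1
    then have "gradient_pair m [(a, d), (c, d)] [(a, d), (c, d), (c, m)]"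
      using assms by (intro gradient_pair_horizontal) (auto simp: face_array_simps)
    then show ?thesis
      by (intro blocked_by_later_face[where ys' = "[(a, d), (c, d), (c, m)]" and r' = 2]) (auto simp: delete_at_def)
  next
    case 2
    then have "gradient_pair m [(a, d), (m, d)] [(a, d), (m, d), (m, m - 1)]"
      using assms by (intro gradient_pair_horizontal_right) (auto simp: face_array_simps)
    then show ?thesis
      by (intro blocked_by_later_face[where ys' = "[(a, d), (c, d), (c, m - 1)]" and r' = 2]) (auto simp: delete_at_def 2)
  next
    case 3
    then have "gradient_pair m [(a, b), (a, d)] [(a, b), (a, d), (c, d)]"
      using assms(2) gradient_pair_vertical gradient_pair_vertical_top by blast
    then show ?thesis
      by (intro blocked_by_coface[where r' = 2]) (auto simp: delete_at_def)
  next
    case 4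
    then have "gradient_pair m [(a, b), (c, d)] [(a, b), (a, d), (c, d)]"
      using assms(2) by (intro gradient_pair_diagonal_upper) auto
    then show ?thesis
      by (intro blocked_by_coface[where r' = 1]) (auto simp: delete_at_def)
  qed
qed

lemma blocked_lower_0:
  assumes "m \<ge> 4" "face_array m [(a, b), (c, b), (c, d)]"
  shows "blocked m [(a, b), (c, b), (c, d)] 0"
proof -
  consider "c < m" "d < m" | "d = m" "c < m - 1" | "d = m \<and> c = m - 1 \<or> c = m \<and> d = m - 1"
    | "c = m" "d < m - 1"
    using assms by (fastforce simp: face_array_simps)
  then show ?thesis
  proof cases
    case 1
    then have "gradient_pair m [(c, b), (c, d)] [(c, b), (c, d), (m, d)]"
      using assms by (intro gradient_pair_vertical) (auto simp: face_array_simps)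
    then show ?thesis
      by (intro blocked_by_later_face[where ys' = "[(c, b), (c, d), (m, d)]" and r' = 2]) (auto simp: delete_at_def)
  next
    case 2
    then have "gradient_pair m [(c, b), (c, m)] [(c, b), (c, m), (m - 1, m)]"
      using assms by (intro gradient_pair_vertical_top) (auto simp: face_array_simps)
    then show ?thesis
      by (intro blocked_by_later_face[where ys' = "[(c, b), (c, d), (m - 1, d)]" and r' = 2]) (auto simp: delete_at_def 2)
  next
    case 3
    then have "gradient_pair m [(a, b), (c, b)] [(a, b), (c, b), (c, d)]"
      using assms(2) gradient_pair_horizontal gradient_pair_horizontal_right by blast
    then show ?thesis
      by (intro blocked_by_coface[where r' = 2]) (auto simp: delete_at_def)
  next
    case 4
    then have "gradient_pair m [(a, b), (c, d)] [(a, b), (c, b), (c, d)]"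
      using assms(2) by (intro gradient_pair_diagonal_lower) auto
    then show ?thesis
      by (intro blocked_by_coface[where r' = 1]) (auto simp: delete_at_def)
  qed
qed

text \<open>
  The largest neighbour of a vertex \<open>(a, b)\<close> is \<open>(m, m - 1)\<close>, except that for \<open>b = m\<close> it is
  \<open>(m - 1, m)\<close>.
\<close>

lemma blocked_edge_1:
  assumes "m \<ge> 4" "face_array m [(a, b), (c, d)]"
    "\<not> gradient_pair m [(a, b)] [(a, b), (c, d)]"
  shows "blocked m [(a, b), (c, d)] 1"
proof (cases "b = m")
  case True
  then have "gradient_pair m [(a, b)] [(a, b), (m - 1, m)]"
    using assms(1,2) by (intro gradient_pair_vertex_top) (auto simp: face_array_simps)
  then show ?thesis
    using assms True
    by (intro blocked_by_face[where ys' = "[(a, b), (m - 1, m)]"])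
      (auto simp: delete_at_def face_array_simps)
next
  case False
  then have "gradient_pair m [(a, b)] [(a, b), (m, m - 1)]"
    using assms(1,2) by (intro gradient_pair_vertex) (auto simp: face_array_simps)
  then show ?thesis
    using assms False
    by (intro blocked_by_face[where ys' = "[(a, b), (m, m - 1)]"])
      (auto simp: delete_at_def face_array_simps)
qed

text \<open>
  At position \<open>0\<close> only the vertices \<open>(m, m - 1)\<close> and \<open>(m - 1, m)\<close> are left. For the first one, all edges
  are used. The second one is paired with its largest smaller neighbour \<open>(m - 1, m - 2)\<close>.
\<close>

lemma blocked_edge_0:
  assumes "m \<ge> 4" "face_array m [(a, b), (c, d)]"
    "\<not> gradient_pair m [(c, d)] [(a, b), (c, d)]"
  shows "blocked m [(a, b), (c, d)] 0"
proof -
  consider "c = m" "d = m - 1" | "c = m - 1" "d = m" | "d = m" "c < m - 1"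
    | "d < m" "(c, d) \<noteq> (m, m - 1)"
    using assms by (fastforce simp: face_array_simps)
  then show ?thesis
  proof cases
    case 1
    then have "gradient_pair m [(a, b)] [(a, b), (c, d)]"
      using assms(2) by (intro gradient_pair_vertex)
    then show ?thesis
      by (intro blocked_by_coface[where r' = 1]) (auto simp: delete_at_def)
  next
    case 2
    then have "gradient_pair m [(c, d)] [(m - 1, m - 2), (c, d)]"
      using assms(1) by (intro gradient_pair_vertex_last) (auto simp: face_array_simps)
    then show ?thesis
      using assms 2
      by (intro blocked_by_face[where ys' = "[(m - 1, m - 2), (c, d)]"])
        (auto simp: delete_at_def face_array_simps)
  next
    case 3
    then have "gradient_pair m [(c, d)] [(c, d), (m - 1, m)]"
      using assms(1,2) by (intro gradient_pair_vertex_top) (auto simp: face_array_simps)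
    then show ?thesis
      by (intro blocked_by_later_face[where ys' = "[(c, d), (m - 1, m)]" and r' = 1]) (auto simp: delete_at_def)
  next
    case 4
    then have "gradient_pair m [(c, d)] [(c, d), (m, m - 1)]"
      using assms(1,2) by (intro gradient_pair_vertex) (auto simp: face_array_simps)
    then show ?thesis
      by (intro blocked_by_later_face[where ys' = "[(c, d), (m, m - 1)]" and r' = 1]) (auto simp: delete_at_def)
  qed
qed

lemma blocked_if_not_gradient_pair:
  assumes "m \<ge> 4" "face_array m ys" "length ys = 2 \<or> length ys = 3" "r < length ys"
    "\<not> gradient_pair m (delete_at r ys) ys"
  shows "blocked m ys r"
  using assms(3)
proof
  assume "length ys = 2"
  then obtain a b c d where ys: "ys = [(a, b), (c, d)]"
    by (auto simp: length_Suc_conv numeral_2_eq_2)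
  then have "r = 0 \<or> r = 1" using assms(4) by auto
  then show ?thesis
    using assms(1,2,5) blocked_edge_0[of m a b c d] blocked_edge_1[of m a b c d]
    by (auto simp: ys delete_at_def)
next
  assume "length ys = 3"
  then obtain a b c d e f where ys: "ys = [(a, b), (e, f), (c, d)]"
    by (auto simp: length_Suc_conv numeral_3_eq_3)
  then have r: "r = 0 \<or> r = 1 \<or> r = 2" using assms(4) by auto
  consider "e = a" "f = d" | "e = c" "f = b"
    using assms(2) by (auto simp: ys face_array_simps)
  then show ?thesis
  proof cases
    case 1
    then show ?thesis
      using r assms(1,2,5) blocked_upper_0[of m a b d c] blocked_upper_1[of m a b d c]
        blocked_upper_2[of m a b d c]
      by (auto simp: ys delete_at_def)
  next
    case 2
    then show ?thesis
      using r assms(1,2,5) blocked_lower_0[of m a b c d] blocked_lower_1[of m a b c d]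
        blocked_lower_2[of m a b c d]
      by (auto simp: ys delete_at_def)
  qed
qed

section \<open>The gradient field\<close>

lemma W_field_eq:
  assumes "m \<ge> 4"
  shows "W_field m = {(set xs, set ys) | xs ys. gradient_pair m xs ys}" (is "_ = ?M")
  unfolding W_field_def
proof (rule algorithm_A_eqI[OF finite_complex_munkres_complex])
  have m: "m \<ge> 3" using assms by simp
  have cand: "candidate (munkres_complex m) (length ys - 2) r (ys ! r) (set (delete_at r ys))"
    "set ys = insert (ys ! r) (set (delete_at r ys))"
    if "face_array m ys" "r < length ys" "length ys = 2 \<or> length ys = 3" for ys r
  proof -
    show "candidate (munkres_complex m) (length ys - 2) r (ys ! r) (set (delete_at r ys))"
      unfolding candidate_munkres_complex[OF m] using that by (intro conjI exI[of _ ys]) auto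
    show "set ys = insert (ys ! r) (set (delete_at r ys))"
      using set_delete_at[OF distinct_face_array[OF that(1)] that(2)] nth_mem[OF that(2)] by blast
  qed
  show "\<exists>i r v. candidate (munkres_complex m) i r v \<alpha> \<and> \<beta> = insert v \<alpha>" if M: "(\<alpha>, \<beta>) \<in> ?M" for \<alpha> \<beta>
  proof -
    obtain xs ys where g: "gradient_pair m xs ys" "\<alpha> = set xs" "\<beta> = set ys"
      using M by blast
    from g(1) obtain r where "xs = delete_at r ys" "r < length ys" "length ys = 2 \<or> length ys = 3"
      by (rule gradient_pair_delete_at)
    then show ?thesis
      using g cand[of ys r] gradient_pair_face_array(2)[OF g(1)] by blast
  qed
  show "{\<alpha>, \<beta>} \<inter> {\<alpha>', \<beta>'} = {}"
    if M: "(\<alpha>, \<beta>) \<in> ?M" "(\<alpha>', \<beta>') \<in> ?M" and ne: "(\<alpha>, \<beta>) \<noteq> (\<alpha>', \<beta>')" for \<alpha> \<beta> \<alpha>' \<beta>'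
  proof -
    obtain xs ys xs' ys' where g: "gradient_pair m xs ys" "gradient_pair m xs' ys'"
      and eq: "\<alpha> = set xs" "\<beta> = set ys" "\<alpha>' = set xs'" "\<beta>' = set ys'"
      using M by blast
    note fa = gradient_pair_face_array[OF g(1)] gradient_pair_face_array[OF g(2)]
    have "xs \<noteq> xs'" "ys \<noteq> ys'"
      using g ne eq gradient_pair_unique_coface gradient_pair_unique_face by blast+
    moreover have "xs \<noteq> ys'" "ys \<noteq> xs'"
      using g not_gradient_pair_chain by blast+
    ultimately have "set xs \<noteq> set xs'" "set ys \<noteq> set ys'" "set xs \<noteq> set ys'" "set ys \<noteq> set xs'"
      using fa face_array_eqI by blast+
    then show ?thesis
      by (simp add: eq)
  qed
  show "\<exists>i' r' v' \<alpha>'. candidate (munkres_complex m) i' r' v' \<alpha>' \<and> (\<alpha>', insert v' \<alpha>') \<in> ?M \<and>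
      precedes (i', r', v') (i, r, v) \<and> {\<alpha>, insert v \<alpha>} \<inter> {\<alpha>', insert v' \<alpha>'} \<noteq> {}"
    if c: "candidate (munkres_complex m) i r v \<alpha>" and notM: "(\<alpha>, insert v \<alpha>) \<notin> ?M" for i r v \<alpha>
  proof -
    obtain ys where ys: "i < 2" "r < i + 2" "face_array m ys" "length ys = i + 2" "v = ys ! r"
      "\<alpha> = set (delete_at r ys)"
      using c by (auto simp: candidate_munkres_complex[OF m])
    have "set ys = insert (ys ! r) (set (delete_at r ys))"
      using ys(1-4) by (intro cand(2)) auto
    then have \<beta>: "insert v \<alpha> = set ys"
      by (simp only: ys(5,6))
    then have "\<not> gradient_pair m (delete_at r ys) ys"
      using notM ys(6) by blast
    then have "blocked m ys r"
      using ys by (intro blocked_if_not_gradient_pair assms) auto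
    then obtain ys' r' where b: "gradient_pair m (delete_at r' ys') ys'" "length ys' = length ys"
      "r' < length ys" "r < r' \<or> r = r' \<and> ys ! r < ys' ! r'"
      "delete_at r' ys' = delete_at r ys \<or> ys' = ys"
      unfolding blocked_def by blast
    have len: "length ys' = 2 \<or> length ys' = 3" "r' < length ys'" "length ys' - 2 = i"
      using b(2,3) ys(1,4) by auto
    note c' = cand[of ys' r', OF gradient_pair_face_array(2)[OF b(1)] len(2,1), unfolded len(3)]
    have "precedes (i, r', ys' ! r') (i, r, v)"
      using b(4) ys(5) by auto
    moreover have "(set (delete_at r' ys'), set ys') \<in> ?M"
      using b(1) by blast
    moreover have "{\<alpha>, insert v \<alpha>} \<inter> {set (delete_at r' ys'), set ys'} \<noteq> {}"
      using b(5)
    proof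
      assume "delete_at r' ys' = delete_at r ys"
      then show ?thesis by (simp add: ys(6))
    next
      assume "ys' = ys"
      then show ?thesis by (simp add: \<beta>)
    qed
    ultimately show ?thesis
      unfolding c'(2) using c'(1) by blast
  qed
qed

section \<open>The critical faces\<close>

definition critical :: "nat \<Rightarrow> (nat \<times> nat) list \<Rightarrow> bool" where
  "critical m xs \<longleftrightarrow> face_array m xs \<and> (\<forall>ys. \<not> gradient_pair m xs ys \<and> \<not> gradient_pair m ys xs)"

lemma critical_iff_unmatched:
  assumes "m \<ge> 4"
  shows "critical m xs \<longleftrightarrow> face_array m xs \<and> (\<forall>(\<alpha>, \<beta>) \<in> W_field m. set xs \<noteq> \<alpha> \<and> set xs \<noteq> \<beta>)"
    (is "_ \<longleftrightarrow> ?R")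
proof
  assume c: "critical m xs"
  then have xs: "face_array m xs"
    by (simp add: critical_def)
  have "set xs \<noteq> set us \<and> set xs \<noteq> set vs" if g: "gradient_pair m us vs" for us vs
    using g c gradient_pair_face_array[OF g] face_array_eqI[OF xs] unfolding critical_def by blast
  then show ?R
    using xs by (auto simp: W_field_eq[OF assms])
next
  assume ?R
  then show "critical m xs"
    unfolding W_field_eq[OF assms] critical_def by blast
qed

lemma critical_faces_eq:
  assumes "m \<ge> 4"
  shows "critical_faces (munkres_complex m) (W_field m) k =
    {set xs | xs. critical m xs \<and> length xs = k + 1}"
proof -
  have restrict: "{\<sigma> \<in> {set xs | xs. A xs}. P \<sigma>} = {set xs | xs. A xs \<and> P (set xs)}"
    for A and P :: "(nat \<times> nat) set \<Rightarrow> bool"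
    by blast
  show ?thesis
    unfolding critical_faces_def faces_munkres_complex restrict critical_iff_unmatched[OF assms]
    by (simp add: conj_ac)
qed

lemma critical_vertex:
  assumes "m \<ge> 4"
  shows "critical m [(a, b)] \<longleftrightarrow> (a, b) = (m, m - 1)"
proof
  assume "(a, b) = (m, m - 1)"
  then show "critical m [(a, b)]"
    using assms by (auto simp: critical_def gradient_pair_def face_array_simps)
next
  assume c: "critical m [(a, b)]"
  then have *: "a \<le> m" "b \<le> m" "a \<noteq> b" "1 \<le> a" "1 \<le> b"
    by (auto simp: critical_def face_array_simps)
  show "(a, b) = (m, m - 1)"
  proof (rule ccontr)
    assume ne: "(a, b) \<noteq> (m, m - 1)"
    consider "b < m" | "b = m" "a < m - 1" | "b = m" "a = m - 1"
      using * by linarith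
    then have "\<exists>ys. gradient_pair m [(a, b)] ys"
    proof cases
      case 1
      then have "gradient_pair m [(a, b)] [(a, b), (m, m - 1)]"
        using * ne by (intro gradient_pair_vertex) (auto simp: face_array_simps)
      then show ?thesis ..
    next
      case 2
      then have "gradient_pair m [(a, b)] [(a, b), (m - 1, m)]"
        using * by (intro gradient_pair_vertex_top) (auto simp: face_array_simps)
      then show ?thesis ..
    next
      case 3
      then have "gradient_pair m [(a, b)] [(m - 1, m - 2), (a, b)]"
        using * assms by (intro gradient_pair_vertex_last) (auto simp: face_array_simps)
      then show ?thesis ..
    qed
    then show False using c by (auto simp: critical_def)
  qed
qed

text \<open>
  A lower triangle is always used, by its horizontal edge if \<open>d = m\<close> or \<open>c = m\<close> and \<open>d = m - 1\<close>, and by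
  its diagonal otherwise. An upper triangle remains if \<open>(c, d)\<close> has no entry \<open>m\<close> and the diagonal edge
  prefers the lower triangle, which is a face just if \<open>b \<noteq> c\<close>.
\<close>

lemma critical_triangle:
  assumes "m \<ge> 4" "face_array m [(a, b), (e, f), (c, d)]"
  shows "critical m [(a, b), (e, f), (c, d)] \<longleftrightarrow> e = a \<and> f = d \<and> b \<noteq> c \<and> c < m \<and> d < m"
proof
  assume "e = a \<and> f = d \<and> b \<noteq> c \<and> c < m \<and> d < m"
  then show "critical m [(a, b), (e, f), (c, d)]"
    using assms by (auto simp: critical_def gradient_pair_def face_array_simps)
next
  assume "critical m [(a, b), (e, f), (c, d)]"
  then have no: "\<not> gradient_pair m xs [(a, b), (e, f), (c, d)]" for xs
    by (simp add: critical_def)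
  have le: "c \<le> m" "d \<le> m" "c \<noteq> d" "a < c" "b < d"
    using assms(2) by (auto simp: face_array_simps)
  consider (upper) "e = a" "f = d" | (lower) "e = c" "f = b"
    using assms(2) by (auto simp: face_array_simps)
  then show "e = a \<and> f = d \<and> b \<noteq> c \<and> c < m \<and> d < m"
  proof cases
    case upper
    note T = assms(2)[unfolded upper]
    have "c \<noteq> m" "\<not> (d = m \<and> c = m - 1)" "\<not> (b = c \<and> c < m \<and> d < m)" "\<not> (d = m \<and> c < m - 1)"
      using no gradient_pair_vertical[OF T] gradient_pair_vertical_top[OF T] gradient_pair_diagonal_upper[OF T]
      unfolding upper by blast+
    then show ?thesis
      using upper le by linarith
  next
    case lower
    note T = assms(2)[unfolded lower]
    have "d \<noteq> m" "\<not> (c = m \<and> d = m - 1)" "\<not> (c < m \<and> d < m)" "\<not> (c = m \<and> d < m - 1)"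
      using no gradient_pair_horizontal[OF T] gradient_pair_horizontal_right[OF T] gradient_pair_diagonal_lower[OF T]
      unfolding lower by blast+
    then show ?thesis
      using le by linarith
  qed
qed

text \<open>
  A critical edge has no free triangle above it, and its larger vertex is not the partner of the
  smaller one. A vertical edge is not extended to the right only if \<open>a = m\<close>, or \<open>a = m - 1\<close> and
  \<open>d = m\<close>; similarly for horizontal edges, where \<open>c = m\<close> and \<open>b = d = m - 1\<close> is used by a vertex.
  A diagonal edge is unpaired upwards only if \<open>(c, d)\<close> is \<open>(m, m - 1)\<close> or \<open>(m - 1, m)\<close>, and the former is
  the partner of \<open>(a, b)\<close>.
\<close>

lemma critical_edge:
  assumes "m \<ge> 4" "face_array m [(a, b), (c, d)]"
  shows "critical m [(a, b), (c, d)] \<longleftrightarrow>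
    c = m - 1 \<and> d = m \<and> (a = m - 1 \<and> b + 1 < m - 1 \<or> a < m - 1 \<and> b \<le> m - 1) \<or>
    a = m \<and> c = m \<and> d < m - 1 \<or> b = m \<and> d = m \<and> c < m - 1" (is "_ \<longleftrightarrow> ?R")
proof
  assume ?R
  then show "critical m [(a, b), (c, d)]"
    using assms by (auto simp: critical_def gradient_pair_def face_array_simps)
next
  assume "critical m [(a, b), (c, d)]"
  then have no: "\<not> gradient_pair m xs [(a, b), (c, d)]" "\<not> gradient_pair m [(a, b), (c, d)] xs" for xs
    by (simp_all add: critical_def)
  note E = assms(2)
  have v: "1 \<le> a" "1 \<le> b" "a \<noteq> b" "c \<noteq> d" "a \<le> c" "b \<le> d" "c \<le> m" "d \<le> m" "a \<noteq> c \<or> b \<noteq> d"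
    using E by (auto simp: face_array_simps)
  have not_vertex: "\<not> (c = m \<and> d = m - 1)"
    using no(1) gradient_pair_vertex[OF E] by blast
  have not_vertex_top: "\<not> (c = m - 1 \<and> b = m)"
    using no(1) gradient_pair_vertex_top[OF E] by blast
  have not_vertex_last: "\<not> (a = m - 1 \<and> b = m - 2 \<and> c = m - 1 \<and> d = m)"
    using no(1) gradient_pair_vertex_last[OF E] by blast
  consider "a = c" | "b = d" | "a < c" "b < d" using v by linarith
  then show ?R
  proof cases
    case 1
    have "\<not> (d < m \<and> a < m)"
      using no(2) gradient_pair_vertical[of m a b d m] E 1 by (auto simp: face_array_simps)
    moreover have "\<not> (d = m \<and> a < m - 1)"
      using no(2)[of "[(a, b), (a, d), (m - 1, m)]"] gradient_pair_vertical_top[of m a b d "m - 1"] E 1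
      by (auto simp: face_array_simps)
    ultimately consider "a = m" | "d = m" "a = m - 1"
      using v(5,7,8) by linarith
    then show ?thesis
    proof cases
      case 1
      then have "d < m - 1"
        using v(4,8) not_vertex \<open>a = c\<close> by linarith
      then show ?thesis
        using 1 \<open>a = c\<close> by simp
    next
      case 2
      then have "b + 1 < m - 1"
        using v(3,6,9) not_vertex_last \<open>a = c\<close> by linarith
      then show ?thesis
        using 2 \<open>a = c\<close> by simp
    qed
  next
    case 2
    have "\<not> (c < m \<and> b < m)"
      using no(2) gradient_pair_horizontal[of m a b c m] E 2 by (auto simp: face_array_simps)
    moreover have "\<not> (c = m \<and> b < m - 1)"
      using no(2)[of "[(a, b), (c, d), (m, m - 1)]"] gradient_pair_horizontal_right[of m a b c "m - 1"] E 2
      by (auto simp: face_array_simps)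
    ultimately have "b = m"
      using v(7,8) not_vertex 2 by linarith
    moreover from this have "c < m - 1"
      using v(4,7) not_vertex_top 2 by linarith
    ultimately show ?thesis
      using 2 by simp
  next
    case 3
    have "\<not> (b \<noteq> c \<and> (c < m \<and> d < m \<or> c = m \<and> d < m - 1))"
      using no(2) gradient_pair_diagonal_lower[of m a b c d] E 3 by (auto simp: face_array_simps)
    moreover have not_upper: "\<not> (a \<noteq> d \<and> (b = c \<and> c < m \<and> d < m \<or> d = m \<and> c < m - 1))"
      using no(2) gradient_pair_diagonal_upper[of m a b d c] E 3 by (auto simp: face_array_simps)
    ultimately have "d = m"
      using v(7,8) 3 not_vertex by linarith
    moreover from this have "a \<noteq> d" "c \<noteq> m" "\<not> c < m - 1"
      using v(4,7) 3 not_upper by auto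
    then have "c = m - 1"
      using v(7) by linarith
    ultimately have "d = m" "c = m - 1" "a < m - 1" "b \<le> m - 1"
      using 3 by simp_all
    then show ?thesis
      by simp
  qed
qed

lemma critical_faces_0:
  assumes "m \<ge> 4"
  shows "critical_faces (munkres_complex m) (W_field m) 0 = {set [(m, m - 1)]}"
proof -
  have "critical m xs \<and> length xs = 0 + 1 \<longleftrightarrow> xs = [(m, m - 1)]" for xs
    using critical_vertex[OF assms] by (cases xs) auto
  then show ?thesis
    unfolding critical_faces_eq[OF assms] by simp
qed

lemma critical_faces_1:
  assumes "m \<ge> 4"
  shows "critical_faces (munkres_complex m) (W_field m) 1 = {set xs | xs. face_array m xs \<and>
       ((\<exists>a b. xs = [(a, b), (m - 1, m)] \<and>
           (a = m - 1 \<and> m - 1 > b + 1 \<or> a < m - 1 \<and> m - 1 \<ge> b)) \<or>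
        (\<exists>b d. xs = [(m, b), (m, d)] \<and> d < m - 1) \<or>
        (\<exists>a c. xs = [(a, m), (c, m)] \<and> c < m - 1))}" (is "_ = {set xs | xs. ?P xs}")
proof -
  have "critical m xs \<and> length xs = 1 + 1 \<longleftrightarrow> ?P xs" for xs
  proof -
    have "\<exists>a b c d. xs = [(a, b), (c, d)]" if "length xs = 1 + 1"
      using that by (auto simp: length_Suc_conv)
    moreover have "face_array m xs" if "critical m xs"
      using that by (simp add: critical_def)
    ultimately show ?thesis
      using critical_edge[OF assms] by auto
  qed
  then show ?thesis
    unfolding critical_faces_eq[OF assms] by simp
qed

lemma critical_faces_2:
  assumes "m \<ge> 4"
  shows "critical_faces (munkres_complex m) (W_field m) 2 = {set xs | xs. face_array m xs \<and>
       (\<exists>a b c d. xs = [(a, b), (a, d), (c, d)] \<and> b \<noteq> c \<and> c < m \<and> m > d)}"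
    (is "_ = {set xs | xs. ?P xs}")
proof -
  have "critical m xs \<and> length xs = 2 + 1 \<longleftrightarrow> ?P xs" for xs
  proof -
    have "\<exists>a b c d e f. xs = [(a, b), (e, f), (c, d)]" if "length xs = 2 + 1"
      using that by (auto simp: length_Suc_conv numeral_2_eq_2)
    moreover have "face_array m xs" if "critical m xs"
      using that by (simp add: critical_def)
    ultimately show ?thesis
      using critical_triangle[OF assms] by auto
  qed
  then show ?thesis
    unfolding critical_faces_eq[OF assms] by simp
qed

lemma critical_faces_above_2:
  assumes "m \<ge> 4"
  shows "\<forall>k > 2. critical_faces (munkres_complex m) (W_field m) k = {}"
  using face_array_length_le_3 unfolding critical_faces_eq[OF assms] critical_def by fastforce

theorem proposition4p1:
  fixes m :: nat
  assumes "m \<ge> 4"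
  shows
    "W_field m = {(set xs, set ys) | xs ys. face_array m xs \<and> face_array m ys \<and>
       ((\<exists>a b d. xs = [(a, b), (a, d)] \<and> ys = [(a, b), (a, d), (m, d)] \<and> a < m \<and> m > d) \<or>
        (\<exists>a b. xs = [(a, b), (a, m)] \<and> ys = [(a, b), (a, m), (m - 1, m)] \<and> a < m - 1) \<or>
        (\<exists>a b c. xs = [(a, b), (c, b)] \<and> ys = [(a, b), (c, b), (c, m)] \<and> b < m \<and> m > c) \<or>
        (\<exists>a b. xs = [(a, b), (m, b)] \<and> ys = [(a, b), (m, b), (m, m - 1)] \<and> b < m - 1) \<or>
        (\<exists>a b c d. xs = [(a, b), (c, d)] \<and> ys = [(a, b), (c, b), (c, d)] \<and>
           a < c \<and> b < d \<and> b \<noteq> c \<and> (c < m \<and> m > d \<or> c = m \<and> m > d + 1)) \<or>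
        (\<exists>a b c d. xs = [(a, b), (c, d)] \<and> ys = [(a, b), (a, d), (c, d)] \<and>
           a < c \<and> b < d \<and> a \<noteq> d \<and> (b = c \<and> c < m \<and> m > d \<or> c + 1 < m \<and> m = d)) \<or>
        (\<exists>a b. xs = [(a, b)] \<and> ys = [(a, b), (m, m - 1)] \<and>
           (b < m - 1 \<or> a < m - 1 \<and> m - 1 = b)) \<or>
        (\<exists>a. xs = [(a, m)] \<and> ys = [(a, m), (m - 1, m)] \<and> a < m - 1) \<or>
        (xs = [(m - 1, m)] \<and> ys = [(m - 1, m - 2), (m - 1, m)]))} \<and>
     critical_faces (munkres_complex m) (W_field m) 0 = {set [(m, m - 1)]} \<and>
     critical_faces (munkres_complex m) (W_field m) 1 = {set xs | xs. face_array m xs \<and>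
       ((\<exists>a b. xs = [(a, b), (m - 1, m)] \<and>
           (a = m - 1 \<and> m - 1 > b + 1 \<or> a < m - 1 \<and> m - 1 \<ge> b)) \<or>
        (\<exists>b d. xs = [(m, b), (m, d)] \<and> d < m - 1) \<or>
        (\<exists>a c. xs = [(a, m), (c, m)] \<and> c < m - 1))} \<and>
     critical_faces (munkres_complex m) (W_field m) 2 = {set xs | xs. face_array m xs \<and>
       (\<exists>a b c d. xs = [(a, b), (a, d), (c, d)] \<and> b \<noteq> c \<and> c < m \<and> m > d)} \<and>
     (\<forall>k > 2. critical_faces (munkres_complex m) (W_field m) k = {})"
  using W_field_eq[OF assms, unfolded gradient_pair_def] critical_faces_0[OF assms]
    critical_faces_1[OF assms] critical_faces_2[OF assms] critical_faces_above_2[OF assms]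
  by (intro conjI)

end
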